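(* Let $\mathcal L$ be a filter algebra, fix a g-filter $\mathcal F$ of $\mathcal L$, and let $*$ be the associated group operation on the set of all g-filters of $\mathcal L$. Then the relation $\sim$ ("untwisted relative to") is a congruence relation on the group of g-filters of $\mathcal L$: it is an equivalence relation on the set of g-filters, and whenever $\mathcal G_1\sim\mathcal G_2$ and $\mathcal H_1\sim\mathcal H_2$ are g-filters, $\mathcal G_1*\mathcal H_1\sim\mathcal G_2*\mathcal H_2$.
   Context: **Cubic algebras.** A cubic algebra is a join semilattice $\mathcal L$ with greatest element $\mathbf 1$ and an operation $\Delta(y,x)$ (used only for $x\le y$) such that: (a) $x\le y$ implies $\Delta(y,x)\vee x=y$; (b) $x\le y\le z$ implies $\Delta(z,\Delta(y,x))=\Delta(\Delta(z,y),\Delta(z,x))$; (c) $x\le y$ implies $\Delta(y,\Delta(y,x))=x$; (d) $x\le y\le z$ implies $\Delta(z,x)\le\Delta(z,y)$; and, writing $xy=x\to y:=\Delta(\mathbf 1,\Delta(x\vee y,y))\vee y$, (e) $(xy)y=x\vee y$; (f) $x(yz)=y(xz)$. A meet $x\wedge y$ is the greatest lower bound, which need not exist. **Implication algebras and filter algebras.** An implication algebra is (equivalently) a join semilattice with $1$ in which each interval $[a,1]$ is a Boolean algebra; $a\to b$ is the complement of $a\vee b$ in $[b,1]$. It is an implication lattice if all binary meets exist. For an implication algebra $I$, $\mathscr I(I)=\{\langle a,b\rangle : a,b\in I,\ a\vee b=1,\ a\wedge b\text{ exists}\}$ with componentwise order and join, $\mathbf 1=\langle 1,1\rangle$, and $\Delta(\langle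 a,b\rangle,\langle c,d\rangle)=\langle a\wedge(b\to d),\,b\wedge(a\to c)\rangle$ for $\langle c,d\rangle\le\langle a,b\rangle$; this is a cubic algebra. A filter algebra is a cubic algebra isomorphic to $\mathscr I(I)$ for some implication lattice $I$. **Filters.** A filter in a cubic algebra is a nonempty upward closed subset in which any two elements have a meet that again lies in the subset. For a filter $\mathcal F$, $[[\mathcal F]]$ is the cubic subalgebra it generates (it equals $\{\Delta(x,y): y\le x,\ x,y\in\mathcal F\}$). $\mathcal F$ is a g-filter of $\mathcal L$ if $[[\mathcal F]]=\mathcal L$. If $\mathcal G$ is a g-filter of $\mathcal L$, then for every $x\in\mathcal L$ there are unique $\alpha_{\mathcal G}(x)\ge\beta_{\mathcal G}(x)$ in $\mathcal G$ with $x=\Delta(\alpha_{\mathcal G}(x),\beta_{\mathcal G}(x))$, and $x\mapsto\langle\Delta(\mathbf 1,x)\vee\beta_{\mathcal G}(x),\,x\vee\beta_{\mathcal G}(x)\rangle$ is an isomorphism $\mathcal L\cong\mathscr I(\mathcal G)$ (known facts). **Untwisted.** For an implication lattice $\mathcal G$, $B_{\mathcal G}=\mathcal G\times\{0,1\}$ is the Boolean algebra in which $g\mapsto\langle g,1\rangle$ embeds $\mathcal G$ as an ultrafilter and $\overline{\langle g,i\rangle}=\langle g,1-i\rangle$: explicitly $\langle a,1\rangle\vee\langle b,1\rangle=\langle a\vee b,1\rangle$, $\langle a,0\rangle\vee\langle b,0\rangle=\langle a\wedge b,0\rangle$, $\langle a,1\rangle\vee\langle b,0\rangle=\langle b\to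 a,1\rangle$, with top $\langle 1,1\rangle$ and bottom $\langle 1,0\rangle$. For a g-filter $\mathcal G$ of $\mathcal L$ let $\phi_{\mathcal G}:\mathcal L\to\mathscr I(B_{\mathcal G})$ be $\phi_{\mathcal G}(x)=\langle\langle\Delta(\mathbf 1,x)\vee\beta_{\mathcal G}(x),1\rangle,\langle x\vee\beta_{\mathcal G}(x),1\rangle\rangle$. A g-filter $\mathcal F$ is untwisted relative to the g-filter $\mathcal G$, written $\mathcal F\sim\mathcal G$, iff there is $b\in B_{\mathcal G}$ with $\langle\overline b,b\rangle\le\phi_{\mathcal G}(f)$ for all $f\in\mathcal F$. **Group of g-filters.** With the g-filter $\mathcal F$ fixed, $\mathcal G*\mathcal H=\{\Delta(\beta_{\mathcal G}(\alpha_{\mathcal F}(h)),\beta_{\mathcal G}(h)) : h\in\mathcal H\}$ for g-filters $\mathcal G,\mathcal H$. It is known that this makes the set of g-filters of $\mathcal L$ a (commutative) group in which every element is its own inverse. *)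

theory Defs
  imports "HOL-Algebra.Lattice"
begin

section \<open>Boolean lattices and implication algebras\<close>

locale boolean_lattice = bounded_lattice +
  assumes inf_sup_distrib:
      "\<lbrakk>x \<in> carrier L; y \<in> carrier L; z \<in> carrier L\<rbrakk>
        \<Longrightarrow> x \<sqinter> (y \<squnion> z) = (x \<sqinter> y) \<squnion> (x \<sqinter> z)"
    and complement_exists:
      "x \<in> carrier L \<Longrightarrow> \<exists>y \<in> carrier L. x \<squnion> y = \<top> \<and> x \<sqinter> y = \<bottom>"

definition up_interval :: "('a, 'm) gorder_scheme \<Rightarrow> 'a \<Rightarrow> ('a, 'm) gorder_scheme" where
  "up_interval I a = I\<lparr>carrier := \<lbrace>a..\<top>\<^bsub>I\<^esub>\<rbrace>\<^bsub>I\<^esub>\<rparr>"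

locale implication_algebra = upper_semilattice + weak_partial_order_top +
  assumes boolean_up_interval: "a \<in> carrier L \<Longrightarrow> boolean_lattice (up_interval L a)"

locale implication_lattice = implication_algebra + lattice

definition impl :: "('a, 'm) gorder_scheme \<Rightarrow> 'a \<Rightarrow> 'a \<Rightarrow> 'a" where
  "impl I a b = (THE c. c \<in> carrier (up_interval I b) \<and>
      (a \<squnion>\<^bsub>I\<^esub> b) \<squnion>\<^bsub>up_interval I b\<^esub> c = \<top>\<^bsub>up_interval I b\<^esub> \<and>
      (a \<squnion>\<^bsub>I\<^esub> b) \<sqinter>\<^bsub>up_interval I b\<^esub> c = \<bottom>\<^bsub>up_interval I b\<^esub>)"

section \<open>Cubic algebras\<close>

text \<open>The join and the greatest element are the order-theoretic ones of \<^theory>\<open>HOL-Algebra.Lattice\<close>.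
  \<open>Delta L y x\<close> is meaningful only for \<open>x \<sqsubseteq> y\<close> in the carrier.\<close>

record 'a cubic = "'a gorder" +
  Delta :: "'a \<Rightarrow> 'a \<Rightarrow> 'a" (\<open>\<Delta>\<index>\<close>)

definition cubic_impl :: "('a, 'm) cubic_scheme \<Rightarrow> 'a \<Rightarrow> 'a \<Rightarrow> 'a" (infixr \<open>\<leadsto>\<index>\<close> 75) where
  "x \<leadsto>\<^bsub>L\<^esub> y = \<Delta>\<^bsub>L\<^esub> \<top>\<^bsub>L\<^esub> (\<Delta>\<^bsub>L\<^esub> (x \<squnion>\<^bsub>L\<^esub> y) y) \<squnion>\<^bsub>L\<^esub> y"

locale cubic_algebra = upper_semilattice L + weak_partial_order_top L for L (structure) +
  assumes Delta_closed: "\<lbrakk>x \<in> carrier L; y \<in> carrier L; x \<sqsubseteq> y\<rbrakk> \<Longrightarrow> \<Delta> y x \<in> carrier L"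
    and Delta_join: "\<lbrakk>x \<in> carrier L; y \<in> carrier L; x \<sqsubseteq> y\<rbrakk> \<Longrightarrow> \<Delta> y x \<squnion> x = y"
    and Delta_Delta:
      "\<lbrakk>x \<in> carrier L; y \<in> carrier L; z \<in> carrier L; x \<sqsubseteq> y; y \<sqsubseteq> z\<rbrakk>
        \<Longrightarrow> \<Delta> z (\<Delta> y x) = \<Delta> (\<Delta> z y) (\<Delta> z x)"
    and Delta_involution: "\<lbrakk>x \<in> carrier L; y \<in> carrier L; x \<sqsubseteq> y\<rbrakk> \<Longrightarrow> \<Delta> y (\<Delta> y x) = x"
    and Delta_mono:
      "\<lbrakk>x \<in> carrier L; y \<in> carrier L; z \<in> carrier L; x \<sqsubseteq> y; y \<sqsubseteq> z\<rbrakk> \<Longrightarrow> \<Delta> z x \<sqsubseteq> \<Delta> z y"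
    and impl_impl: "\<lbrakk>x \<in> carrier L; y \<in> carrier L\<rbrakk> \<Longrightarrow> (x \<leadsto> y) \<leadsto> y = x \<squnion> y"
    and impl_left_commute:
      "\<lbrakk>x \<in> carrier L; y \<in> carrier L; z \<in> carrier L\<rbrakk> \<Longrightarrow> x \<leadsto> (y \<leadsto> z) = y \<leadsto> (x \<leadsto> z)"

definition cubic_iso :: "('a, 'm) cubic_scheme \<Rightarrow> ('b, 'n) cubic_scheme \<Rightarrow> ('a \<Rightarrow> 'b) set" where
  "cubic_iso L M = {f. bij_betw f (carrier L) (carrier M) \<and>
     f \<top>\<^bsub>L\<^esub> = \<top>\<^bsub>M\<^esub> \<and>
     (\<forall>x \<in> carrier L. \<forall>y \<in> carrier L. f (x \<squnion>\<^bsub>L\<^esub> y) = f x \<squnion>\<^bsub>M\<^esub> f y) \<and>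
     (\<forall>x \<in> carrier L. \<forall>y \<in> carrier L. x \<sqsubseteq>\<^bsub>L\<^esub> y \<longrightarrow> f (\<Delta>\<^bsub>L\<^esub> y x) = \<Delta>\<^bsub>M\<^esub> (f y) (f x))}"

section \<open>Filter algebras\<close>

text \<open>The order on \<open>\<I>(I)\<close> is componentwise, and then so is the join.\<close>

definition interval_algebra :: "('a, 'm) gorder_scheme \<Rightarrow> ('a \<times> 'a) cubic" where
  "interval_algebra I =
     \<lparr>carrier = {(a, b). a \<in> carrier I \<and> b \<in> carrier I \<and> a \<squnion>\<^bsub>I\<^esub> b = \<top>\<^bsub>I\<^esub> \<and>
                   (\<exists>m. greatest I m (Lower I {a, b}))},
      eq = (=),
      le = (\<lambda>(a, b) (c, d). a \<sqsubseteq>\<^bsub>I\<^esub> c \<and> b \<sqsubseteq>\<^bsub>I\<^esub> d),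
      Delta = (\<lambda>(a, b) (c, d). (a \<sqinter>\<^bsub>I\<^esub> impl I b d, b \<sqinter>\<^bsub>I\<^esub> impl I a c))\<rparr>"

text \<open>HOL cannot quantify over the type of the elements of the implication lattice, so that
  type is a parameter.\<close>

definition filter_algebra :: "'b itself \<Rightarrow> ('a, 'm) cubic_scheme \<Rightarrow> bool" where
  "filter_algebra T L \<longleftrightarrow> cubic_algebra L \<and>
     (\<exists>I :: 'b gorder. implication_lattice I \<and> cubic_iso L (interval_algebra I) \<noteq> {})"

section \<open>Filters\<close>

definition cubic_filter :: "('a, 'm) cubic_scheme \<Rightarrow> 'a set \<Rightarrow> bool" where
  "cubic_filter L F \<longleftrightarrow> F \<noteq> {} \<and> F \<subseteq> carrier L \<and>
     (\<forall>x \<in> F. \<forall>y \<in> carrier L. x \<sqsubseteq>\<^bsub>L\<^esub> y \<longrightarrow> y \<in> F) \<and>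
     (\<forall>x \<in> F. \<forall>y \<in> F. \<exists>m \<in> F. greatest L m (Lower L {x, y}))"

definition cubic_subalgebra :: "('a, 'm) cubic_scheme \<Rightarrow> 'a set \<Rightarrow> bool" where
  "cubic_subalgebra L S \<longleftrightarrow> S \<subseteq> carrier L \<and> \<top>\<^bsub>L\<^esub> \<in> S \<and>
     (\<forall>x \<in> S. \<forall>y \<in> S. x \<squnion>\<^bsub>L\<^esub> y \<in> S) \<and>
     (\<forall>x \<in> S. \<forall>y \<in> S. x \<sqsubseteq>\<^bsub>L\<^esub> y \<longrightarrow> \<Delta>\<^bsub>L\<^esub> y x \<in> S)"

definition generated_subalgebra :: "('a, 'm) cubic_scheme \<Rightarrow> 'a set \<Rightarrow> 'a set" where
  "generated_subalgebra L F = \<Inter> {S. cubic_subalgebra L S \<and> F \<subseteq> S}"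

definition g_filter :: "('a, 'm) cubic_scheme \<Rightarrow> 'a set \<Rightarrow> bool" where
  "g_filter L G \<longleftrightarrow> cubic_filter L G \<and> generated_subalgebra L G = carrier L"

definition alpha_beta :: "('a, 'm) cubic_scheme \<Rightarrow> 'a set \<Rightarrow> 'a \<Rightarrow> 'a \<times> 'a" where
  "alpha_beta L G x =
     (THE (a, b). a \<in> G \<and> b \<in> G \<and> b \<sqsubseteq>\<^bsub>L\<^esub> a \<and> x = \<Delta>\<^bsub>L\<^esub> a b)"

definition alpha :: "('a, 'm) cubic_scheme \<Rightarrow> 'a set \<Rightarrow> 'a \<Rightarrow> 'a" where
  "alpha L G x = fst (alpha_beta L G x)"

definition beta :: "('a, 'm) cubic_scheme \<Rightarrow> 'a set \<Rightarrow> 'a \<Rightarrow> 'a" where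
  "beta L G x = snd (alpha_beta L G x)"

section \<open>The relation \<open>untwisted\<close>\<close>

text \<open>\<open>True\<close> and \<open>False\<close> are the tags \<open>1\<close> and \<open>0\<close> of \<open>B\<^sub>G = G \<times> {0, 1}\<close>.\<close>

fun double_join :: "('a, 'm) gorder_scheme \<Rightarrow> 'a \<times> bool \<Rightarrow> 'a \<times> bool \<Rightarrow> 'a \<times> bool" where
  "double_join G (a, True) (b, True) = (a \<squnion>\<^bsub>G\<^esub> b, True)"
| "double_join G (a, False) (b, False) = (a \<sqinter>\<^bsub>G\<^esub> b, False)"
| "double_join G (a, True) (b, False) = (impl G b a, True)"
| "double_join G (a, False) (b, True) = (impl G a b, True)"

definition double_algebra :: "('a, 'm) gorder_scheme \<Rightarrow> ('a \<times> bool) gorder" where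
  "double_algebra G =
     \<lparr>carrier = carrier G \<times> UNIV, eq = (=), le = (\<lambda>x y. double_join G x y = y)\<rparr>"

definition double_compl :: "'a \<times> bool \<Rightarrow> 'a \<times> bool" where
  "double_compl = (\<lambda>(g, i). (g, \<not> i))"

abbreviation filter_double :: "('a, 'm) cubic_scheme \<Rightarrow> 'a set \<Rightarrow> ('a \<times> bool) gorder" where
  "filter_double L G \<equiv> double_algebra (L\<lparr>carrier := G\<rparr>)"

definition phi ::
  "('a, 'm) cubic_scheme \<Rightarrow> 'a set \<Rightarrow> 'a \<Rightarrow> ('a \<times> bool) \<times> ('a \<times> bool)" where
  "phi L G x =
     ((\<Delta>\<^bsub>L\<^esub> \<top>\<^bsub>L\<^esub> x \<squnion>\<^bsub>L\<^esub> beta L G x, True), (x \<squnion>\<^bsub>L\<^esub> beta L G x, True))"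

definition untwisted :: "('a, 'm) cubic_scheme \<Rightarrow> 'a set \<Rightarrow> 'a set \<Rightarrow> bool" where
  "untwisted L F G \<longleftrightarrow> g_filter L F \<and> g_filter L G \<and>
     (\<exists>b \<in> carrier (filter_double L G). \<forall>f \<in> F.
        (double_compl b, b) \<sqsubseteq>\<^bsub>interval_algebra (filter_double L G)\<^esub> phi L G f)"

definition untwisted_rel :: "('a, 'm) cubic_scheme \<Rightarrow> ('a set \<times> 'a set) set" where
  "untwisted_rel L = {(F, G). untwisted L F G}"

section \<open>The operation on g-filters\<close>

definition g_filter_mult :: "('a, 'm) cubic_scheme \<Rightarrow> 'a set \<Rightarrow> 'a set \<Rightarrow> 'a set \<Rightarrow> 'a set" where
  "g_filter_mult L F G H =
     {\<Delta>\<^bsub>L\<^esub> (beta L G (alpha L F h)) (beta L G h) |h. h \<in> H}"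

end

theory Submission
  imports Defs
begin

text \<open>
  The prime filters of an implication lattice \<open>I\<close> separate its elements, so \<open>I\<close> becomes a family
  \<open>\<S>\<close> of subsets of some set \<open>V\<close> that is closed under intersection and under \<open>- A \<union> B\<close>. The filter
  algebra \<open>L\<close>, being isomorphic to \<open>\<I>(I)\<close>, then consists of the pairs \<open>(P, Q)\<close> of members of \<open>\<S>\<close> that
  cover \<open>V\<close>. Such a pair is a face of the cube \<open>{+, -}\<^sup>V\<close>: the coordinate \<open>v\<close> is fixed to \<open>+\<close> if
  \<open>v \<notin> Q\<close>, fixed to \<open>-\<close> if \<open>v \<notin> P\<close>, and free if \<open>v\<close> lies in the support \<open>P \<inter> Q\<close>. The operation
  \<open>\<Delta> y x\<close> reflects the face \<open>x\<close> through the centre of \<open>y\<close>. All that is left is a calculation with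
  sets (\<open>filter_algebra_face_algebra\<close>).

  In this picture a g-filter is the set of all faces through one vertex \<open>A \<subseteq> V\<close> of the cube: it
  contains exactly one face of every support that occurs in \<open>L\<close>, and any two of its faces agree
  on the coordinates that both of them fix (\<open>g_filter_eq_faces_at\<close>, \<open>g_filter_faces_at\<close>). The product
  of the g-filters at \<open>A\<close> and \<open>B\<close>, formed relative to the g-filter at \<open>C\<close>, is the g-filter at the
  symmetric difference of \<open>A\<close>, \<open>B\<close> and \<open>C\<close> (\<open>g_filter_mult_faces_at\<close>).

  Two g-filters are untwisted relative to each other iff the symmetric difference \<open>D\<close> of their
  vertices is a member of \<open>\<S>\<close> or the complement of one, up to the coordinates that every face
  leaves free (\<open>untwisted_faces_at\<close>). These \<open>D\<close> include the empty set and are closed under symmetric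
  difference (\<open>principal_twist_sym_diff\<close>). Hence the relation is congruence modulo a subgroup of a
  commutative group.
\<close>

section \<open>Order embeddings into power sets\<close>

lemma (in partial_order) join_eqI:
  assumes "x \<in> carrier L" "y \<in> carrier L" "s \<in> carrier L" "x \<sqsubseteq> s" "y \<sqsubseteq> s"
    and "\<And>z. \<lbrakk>z \<in> carrier L; x \<sqsubseteq> z; y \<sqsubseteq> z\<rbrakk> \<Longrightarrow> s \<sqsubseteq> z"
  shows "x \<squnion> y = s"
proof -
  have "least L s (Upper L {x, y})"
    using assms by (auto simp: least_def Upper_def)
  then show ?thesis
    unfolding join_def sup_def by (metis (no_types, lifting) least_unique someI_ex)
qed

lemma (in partial_order) meet_eqI:
  assumes "x \<in> carrier L" "y \<in> carrier L" "s \<in> carrier L" "s \<sqsubseteq> x" "s \<sqsubseteq> y"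
    and "\<And>z. \<lbrakk>z \<in> carrier L; z \<sqsubseteq> x; z \<sqsubseteq> y\<rbrakk> \<Longrightarrow> z \<sqsubseteq> s"
  shows "x \<sqinter> y = s"
proof -
  have "greatest L s (Lower L {x, y})"
    using assms by (auto simp: greatest_def Lower_def)
  then show ?thesis
    unfolding meet_def inf_def by (metis (no_types, lifting) greatest_unique someI_ex)
qed

lemma (in partial_order) bottom_eqI:
  assumes "b \<in> carrier L" "\<And>z. z \<in> carrier L \<Longrightarrow> b \<sqsubseteq> z"
  shows "\<bottom> = b"
proof -
  have "least L b (carrier L)"
    using assms by (auto simp: least_def)
  then show ?thesis
    unfolding bottom_def by (metis (no_types, lifting) least_unique someI_ex)
qed

lemma (in partial_order) top_eqI:
  assumes "t \<in> carrier L" "\<And>z. z \<in> carrier L \<Longrightarrow> z \<sqsubseteq> t"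
  shows "\<top> = t"
proof -
  have "greatest L t (carrier L)"
    using assms by (auto simp: greatest_def)
  then show ?thesis
    unfolding top_def by (metis (no_types, lifting) greatest_unique someI_ex)
qed

text \<open>Closure of the image under \<open>- A \<union> B\<close> forces the join, the greatest element and the relative
  complement of \<open>M\<close> to be the set-theoretic ones. The locale covers an implication lattice, each of
  its intervals up to the top, a filter algebra, and each of its filters.\<close>

locale implication_embedding =
  fixes M :: "('a, 'm) gorder_scheme" (structure) and r :: "'a \<Rightarrow> 'p set"
  assumes eq_eq: "eq M = (=)"
    and nonempty: "carrier M \<noteq> {}"
    and le_iff: "\<lbrakk>x \<in> carrier M; y \<in> carrier M\<rbrakk> \<Longrightarrow> x \<sqsubseteq> y \<longleftrightarrow> r x \<subseteq> r y"
    and inj: "inj_on r (carrier M)"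
    and imp_ex: "\<lbrakk>x \<in> carrier M; y \<in> carrier M\<rbrakk> \<Longrightarrow> \<exists>z \<in> carrier M. r z = - r x \<union> r y"
begin

lemma partial_order: "partial_order M"
  by unfold_locales (use eq_eq le_iff inj in \<open>auto simp: inj_on_def\<close>)

sublocale partial_order M
  by (rule partial_order)

lemma eqI: "\<lbrakk>x \<in> carrier M; y \<in> carrier M; r x = r y\<rbrakk> \<Longrightarrow> x = y"
  using inj by (auto simp: inj_on_def)

lemma join_ex:
  assumes x: "x \<in> carrier M" and y: "y \<in> carrier M"
  shows "\<exists>z \<in> carrier M. r z = r x \<union> r y"
proof -
  obtain u where u: "u \<in> carrier M" "r u = - r x \<union> r y"
    using imp_ex[OF x y] by blast
  obtain z where "z \<in> carrier M" "r z = - r u \<union> r y"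
    using imp_ex[OF u(1) y] by blast
  with u show ?thesis
    by (intro bexI[of _ z]) auto
qed

lemma join_rep:
  assumes "x \<in> carrier M" "y \<in> carrier M"
  shows join_in: "x \<squnion> y \<in> carrier M" and r_join: "r (x \<squnion> y) = r x \<union> r y"
proof -
  obtain s where s: "s \<in> carrier M" "r s = r x \<union> r y"
    using join_ex assms by blast
  have "x \<squnion> y = s"
    by (rule join_eqI) (use assms s le_iff in auto)
  with s show "x \<squnion> y \<in> carrier M" "r (x \<squnion> y) = r x \<union> r y"
    by auto
qed

lemma top_rep: shows top_in: "\<top> \<in> carrier M" and r_top: "r \<top> = UNIV"
proof -
  obtain x where x: "x \<in> carrier M"
    using nonempty by blast
  obtain t where t: "t \<in> carrier M" "r t = UNIV"
    using imp_ex[OF x x] by auto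
  have "\<top> = t"
    by (rule top_eqI) (use t le_iff in auto)
  with t show "\<top> \<in> carrier M" "r \<top> = UNIV"
    by auto
qed

lemma meet_eq:
  assumes "x \<in> carrier M" "y \<in> carrier M" "z \<in> carrier M" "r z = r x \<inter> r y"
  shows "x \<sqinter> y = z"
  by (rule meet_eqI) (use assms le_iff in auto)

text \<open>Implication alone yields the meet of two elements with a common lower bound, because
  \<open>A \<inter> B = - (- A \<union> (- B \<union> C)) \<union> C\<close> for \<open>C \<subseteq> A \<inter> B\<close>.\<close>

lemma bounded_meet_ex:
  assumes "x \<in> carrier M" "y \<in> carrier M" "l \<in> carrier M" "r l \<subseteq> r x \<inter> r y"
  shows "\<exists>z \<in> carrier M. r z = r x \<inter> r y"
proof -
  obtain u where u: "u \<in> carrier M" "r u = - r y \<union> r l"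
    using imp_ex[OF assms(2,3)] by blast
  obtain v where v: "v \<in> carrier M" "r v = - r x \<union> r u"
    using imp_ex[OF assms(1) u(1)] by blast
  obtain z where "z \<in> carrier M" "r z = - r v \<union> r l"
    using imp_ex[OF v(1) assms(3)] by blast
  with u v assms(4) show ?thesis
    by (intro bexI[of _ z]) auto
qed

lemma carrier_up_interval:
  "y \<in> carrier M \<Longrightarrow> carrier (up_interval M y) = {x \<in> carrier M. r y \<subseteq> r x}"
  by (auto simp: up_interval_def at_least_at_most_def le_iff top_in r_top)

lemma implication_embedding_up_interval:
  assumes y: "y \<in> carrier M"
  shows "implication_embedding (up_interval M y) r"
proof
  show "eq (up_interval M y) = (=)"
    by (simp add: up_interval_def eq_eq)
  show "carrier (up_interval M y) \<noteq> {}"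
    using y by (auto simp: carrier_up_interval)
  show "inj_on r (carrier (up_interval M y))"
    using inj y by (auto simp: carrier_up_interval inj_on_def)
  fix u v assume uv: "u \<in> carrier (up_interval M y)" "v \<in> carrier (up_interval M y)"
  then have mem: "u \<in> carrier M" "v \<in> carrier M" "r y \<subseteq> r v"
    using y by (auto simp: carrier_up_interval)
  have "le (up_interval M y) = le M"
    by (simp add: up_interval_def)
  with mem show "u \<sqsubseteq>\<^bsub>up_interval M y\<^esub> v \<longleftrightarrow> r u \<subseteq> r v"
    by (simp add: le_iff)
  obtain w where "w \<in> carrier M" "r w = - r u \<union> r v"
    using imp_ex[OF mem(1,2)] by blast
  with mem y show "\<exists>w \<in> carrier (up_interval M y). r w = - r u \<union> r v"
    by (intro bexI[of _ w]) (auto simp: carrier_up_interval)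
qed

text \<open>The description in the definition of \<^const>\<open>impl\<close> denotes something because complements in a
  power set are unique.\<close>

lemma impl_rep:
  assumes x: "x \<in> carrier M" and y: "y \<in> carrier M"
  shows impl_in: "impl M x y \<in> carrier M" and r_impl: "r (impl M x y) = - r x \<union> r y"
proof -
  interpret U: implication_embedding "up_interval M y" r
    by (rule implication_embedding_up_interval[OF y])
  obtain c where c: "c \<in> carrier M" "r c = - r x \<union> r y"
    using imp_ex x y by blast
  have mem: "x \<squnion> y \<in> carrier (up_interval M y)" "y \<in> carrier (up_interval M y)"
      "c \<in> carrier (up_interval M y)"
    using x y c by (auto simp: carrier_up_interval join_in r_join)
  have bot: "\<bottom>\<^bsub>up_interval M y\<^esub> = y"
    by (rule U.bottom_eqI) (use y mem in \<open>auto simp: U.le_iff carrier_up_interval\<close>)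
  have "impl M x y = c"
    unfolding impl_def bot
  proof (rule the_equality, intro conjI)
    show "c \<in> carrier (up_interval M y)"
      by (rule mem)
    show "(x \<squnion> y) \<squnion>\<^bsub>up_interval M y\<^esub> c = \<top>\<^bsub>up_interval M y\<^esub>"
      by (rule U.eqI) (use mem x y c in \<open>auto simp: U.join_in U.top_in U.r_join U.r_top r_join\<close>)
    show "(x \<squnion> y) \<sqinter>\<^bsub>up_interval M y\<^esub> c = y"
      by (rule U.meet_eq) (use mem x y c in \<open>auto simp: r_join\<close>)
  next
    fix d
    assume d: "d \<in> carrier (up_interval M y) \<and>
      (x \<squnion> y) \<squnion>\<^bsub>up_interval M y\<^esub> d = \<top>\<^bsub>up_interval M y\<^esub> \<and> (x \<squnion> y) \<sqinter>\<^bsub>up_interval M y\<^esub> d = y"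
    then have dm: "d \<in> carrier (up_interval M y)" "d \<in> carrier M" "r y \<subseteq> r d"
      using y by (auto simp: carrier_up_interval)
    have "r ((x \<squnion> y) \<squnion>\<^bsub>up_interval M y\<^esub> d) = UNIV"
      using d by (simp add: U.r_top)
    then have 1: "r x \<union> r d = UNIV"
      using mem dm x y by (auto simp: U.r_join r_join)
    obtain g where g: "g \<in> carrier M" "r g = r (x \<squnion> y) \<inter> r d"
      using bounded_meet_ex[OF join_in[OF x y] dm(2) y] dm(3) x y by (auto simp: r_join)
    then have "(x \<squnion> y) \<sqinter>\<^bsub>up_interval M y\<^esub> d = g"
      by (intro U.meet_eq) (use mem dm y x in \<open>auto simp: carrier_up_interval r_join\<close>)
    with d g have 2: "r y = (r x \<union> r y) \<inter> r d"
      using x y by (auto simp: r_join)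
    have "r d = - r x \<union> r y"
      using 1 2 by blast
    with dm c show "d = c"
      by (intro eqI) auto
  qed
  with c show "impl M x y \<in> carrier M" "r (impl M x y) = - r x \<union> r y"
    by auto
qed

end

section \<open>Implication lattices as families of sets\<close>

lemma (in implication_lattice) up_interval_join:
  assumes a: "a \<in> carrier L" and "x \<in> carrier (up_interval L a)" "y \<in> carrier (up_interval L a)"
  shows "x \<squnion>\<^bsub>up_interval L a\<^esub> y = x \<squnion> y"
proof -
  interpret U: boolean_lattice "up_interval L a"
    using a by (rule boolean_up_interval)
  have "x \<in> carrier L" "y \<in> carrier L" "a \<sqsubseteq> x" "a \<sqsubseteq> y"
    using assms by (auto simp: up_interval_def at_least_at_most_def)
  then show ?thesis
    by (intro U.join_eqI)
      (use assms in \<open>auto simp: up_interval_def at_least_at_most_def join_left join_right top_higher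
        intro: join_le le_trans[of _ x]\<close>)
qed

lemma (in implication_lattice) up_interval_meet:
  assumes a: "a \<in> carrier L" and "x \<in> carrier (up_interval L a)" "y \<in> carrier (up_interval L a)"
  shows "x \<sqinter>\<^bsub>up_interval L a\<^esub> y = x \<sqinter> y"
proof -
  interpret U: boolean_lattice "up_interval L a"
    using a by (rule boolean_up_interval)
  have "x \<in> carrier L" "y \<in> carrier L" "a \<sqsubseteq> x" "a \<sqsubseteq> y"
    using assms by (auto simp: up_interval_def at_least_at_most_def)
  then show ?thesis
    by (intro U.meet_eqI)
      (use assms in \<open>auto simp: up_interval_def at_least_at_most_def meet_left meet_right top_higher
        intro: meet_le\<close>)
qed

text \<open>Three elements lie in a common Boolean interval, namely above their meet.\<close>

lemma (in implication_lattice) meet_join_distrib: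
  assumes "x \<in> carrier L" "y \<in> carrier L" "z \<in> carrier L"
  shows "x \<sqinter> (y \<squnion> z) = (x \<sqinter> y) \<squnion> (x \<sqinter> z)"
proof -
  define a where "a = x \<sqinter> y \<sqinter> z"
  have a: "a \<in> carrier L"
    using assms by (simp add: a_def)
  have le: "a \<sqsubseteq> x" "a \<sqsubseteq> y" "a \<sqsubseteq> z"
    unfolding a_def using assms
    by (meson meet_closed meet_left meet_right le_trans)+
  interpret U: boolean_lattice "up_interval L a"
    using a by (rule boolean_up_interval)
  have mem: "x \<in> carrier (up_interval L a)" "y \<in> carrier (up_interval L a)"
      "z \<in> carrier (up_interval L a)"
    using le assms by (auto simp: up_interval_def at_least_at_most_def top_higher)
  then show ?thesis
    using U.inf_sup_distrib[OF mem] a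
    by (metis U.join_closed U.meet_closed up_interval_join up_interval_meet)
qed

lemma (in implication_lattice) relative_complement_ex:
  assumes x: "x \<in> carrier L" and y: "y \<in> carrier L"
  shows "\<exists>c \<in> carrier L. y \<sqsubseteq> c \<and> (x \<squnion> y) \<squnion> c = \<top> \<and> (x \<squnion> y) \<sqinter> c = y"
proof -
  interpret U: boolean_lattice "up_interval L y"
    using y by (rule boolean_up_interval)
  have m: "x \<squnion> y \<in> carrier (up_interval L y)"
    using assms by (auto simp: up_interval_def at_least_at_most_def top_higher join_right)
  obtain c where c: "c \<in> carrier (up_interval L y)"
      "(x \<squnion> y) \<squnion>\<^bsub>up_interval L y\<^esub> c = \<top>\<^bsub>up_interval L y\<^esub>"
      "(x \<squnion> y) \<sqinter>\<^bsub>up_interval L y\<^esub> c = \<bottom>\<^bsub>up_interval L y\<^esub>"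
    using U.complement_exists[OF m] by blast
  have "\<top>\<^bsub>up_interval L y\<^esub> = \<top>"
    by (rule U.top_eqI) (use y in \<open>auto simp: up_interval_def at_least_at_most_def top_higher\<close>)
  moreover have "\<bottom>\<^bsub>up_interval L y\<^esub> = y"
    by (rule U.bottom_eqI) (use y in \<open>auto simp: up_interval_def at_least_at_most_def top_higher\<close>)
  ultimately show ?thesis
    using c m y by (auto simp: up_interval_join up_interval_meet
        intro!: bexI[of _ c]) (auto simp: up_interval_def at_least_at_most_def)
qed

definition prime_filter :: "('a, 'm) gorder_scheme \<Rightarrow> 'a set \<Rightarrow> bool" where
  "prime_filter I v \<longleftrightarrow> v \<subseteq> carrier I \<and> \<top>\<^bsub>I\<^esub> \<in> v \<and>
     (\<forall>x \<in> carrier I. \<forall>y \<in> carrier I. x \<sqinter>\<^bsub>I\<^esub> y \<in> v \<longleftrightarrow> x \<in> v \<and> y \<in> v) \<and>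
     (\<forall>x \<in> carrier I. \<forall>y \<in> carrier I. x \<squnion>\<^bsub>I\<^esub> y \<in> v \<longrightarrow> x \<in> v \<or> y \<in> v)"

lemma (in implication_lattice) meet_eq_left:
  assumes "x \<in> carrier L" "y \<in> carrier L"
  shows "x \<sqsubseteq> y \<longleftrightarrow> x \<sqinter> y = x"
  using assms by (metis le_refl meet_eqI meet_right)

text \<open>By Zorn's lemma there is a filter that is maximal among those containing \<open>a\<close> but not \<open>b\<close>. If it
  contained \<open>x \<squnion> y\<close> but neither \<open>x\<close> nor \<open>y\<close>, then one of its elements \<open>h\<close> would satisfy
  \<open>h \<sqinter> x \<sqsubseteq> b\<close> and \<open>h \<sqinter> y \<sqsubseteq> b\<close>, and distributivity would put \<open>b\<close> into it.\<close>

lemma (in implication_lattice) prime_filter_separates: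
  assumes a: "a \<in> carrier L" and b: "b \<in> carrier L" and nle: "\<not> a \<sqsubseteq> b"
  shows "\<exists>v. prime_filter L v \<and> a \<in> v \<and> b \<notin> v"
proof -
  define filt where "filt v \<longleftrightarrow> v \<subseteq> carrier L \<and>
     (\<forall>x \<in> v. \<forall>y \<in> v. x \<sqinter> y \<in> v) \<and> (\<forall>x \<in> v. \<forall>y \<in> carrier L. x \<sqsubseteq> y \<longrightarrow> y \<in> v)" for v
  define A where "A = {v. filt v \<and> a \<in> v \<and> b \<notin> v}"
  have "\<exists>v \<in> A. \<forall>X \<in> A. v \<subseteq> X \<longrightarrow> X = v"
  proof (rule subset_Zorn_nonempty)
    have "{x \<in> carrier L. a \<sqsubseteq> x} \<in> A"
      unfolding A_def filt_def using a b nle by (auto intro: meet_le le_trans)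
    then show "A \<noteq> {}"
      by blast
  next
    fix C assume C: "C \<noteq> {}" "subset.chain A C"
    then have sub: "C \<subseteq> A" and lin: "\<And>X Y. X \<in> C \<Longrightarrow> Y \<in> C \<Longrightarrow> X \<subseteq> Y \<or> Y \<subseteq> X"
      by (auto simp: subset.chain_def)
    have "x \<sqinter> y \<in> \<Union>C" if xy: "x \<in> \<Union>C" "y \<in> \<Union>C" for x y
    proof -
      obtain X Y where XY: "x \<in> X" "X \<in> C" "y \<in> Y" "Y \<in> C"
        using xy by blast
      then obtain Z where "Z \<in> C" "x \<in> Z" "y \<in> Z"
        using lin[of X Y] by blast
      moreover from this have "filt Z"
        using sub by (auto simp: A_def)
      ultimately have "x \<sqinter> y \<in> Z"
        by (simp add: filt_def)
      with \<open>Z \<in> C\<close> show ?thesis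
        by blast
    qed
    moreover have "\<And>X. X \<in> C \<Longrightarrow> filt X" "\<Union>C \<subseteq> carrier L" "a \<in> \<Union>C" "b \<notin> \<Union>C"
      using sub C(1) by (auto simp: A_def filt_def)
    moreover have "y \<in> \<Union>C" if "x \<in> \<Union>C" "y \<in> carrier L" "x \<sqsubseteq> y" for x y
      using that \<open>\<And>X. X \<in> C \<Longrightarrow> filt X\<close> unfolding filt_def by blast
    ultimately show "\<Union>C \<in> A"
      unfolding A_def filt_def by simp
  qed
  then obtain v where v: "filt v" "a \<in> v" "b \<notin> v"
      and max: "\<And>X. filt X \<Longrightarrow> v \<subseteq> X \<Longrightarrow> b \<notin> X \<Longrightarrow> X = v"
    unfolding A_def by blast
  have sub: "v \<subseteq> carrier L" and mt: "\<And>x y. x \<in> v \<Longrightarrow> y \<in> v \<Longrightarrow> x \<sqinter> y \<in> v"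
      and up: "\<And>x y. x \<in> v \<Longrightarrow> y \<in> carrier L \<Longrightarrow> x \<sqsubseteq> y \<Longrightarrow> y \<in> v"
    using v(1) by (auto simp: filt_def)
  \<comment> \<open>By maximality, adjoining an element outside \<open>v\<close> puts \<open>b\<close> into the filter.\<close>
  have adjoin: "\<exists>f \<in> v. f \<sqinter> x \<sqsubseteq> b" if x: "x \<in> carrier L" "x \<notin> v" for x
  proof (rule ccontr)
    assume neg: "\<not> ?thesis"
    define X where "X = {z \<in> carrier L. \<exists>f \<in> v. f \<sqinter> x \<sqsubseteq> z}"
    have "z \<sqinter> w \<in> X" if zw: "z \<in> X" "w \<in> X" for z w
    proof -
      obtain f g where fg: "f \<in> v" "g \<in> v" "f \<sqinter> x \<sqsubseteq> z" "g \<sqinter> x \<sqsubseteq> w"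
          and c: "z \<in> carrier L" "w \<in> carrier L"
        using zw by (auto simp: X_def)
      have c': "f \<in> carrier L" "g \<in> carrier L"
        using fg sub by auto
      have "(f \<sqinter> g) \<sqinter> x \<sqsubseteq> f \<sqinter> x" "(f \<sqinter> g) \<sqinter> x \<sqsubseteq> g \<sqinter> x"
        using c' x by (meson meet_closed meet_le meet_left meet_right le_trans)+
      then have "(f \<sqinter> g) \<sqinter> x \<sqsubseteq> z \<sqinter> w"
        using c c' x fg by (meson meet_closed meet_le le_trans)
      then show ?thesis
        using mt[OF fg(1,2)] c by (auto simp: X_def)
    qed
    moreover have "w \<in> X" if zw: "z \<in> X" "w \<in> carrier L" "z \<sqsubseteq> w" for z w
    proof -
      obtain f where "f \<in> v" "f \<sqinter> x \<sqsubseteq> z" "z \<in> carrier L"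
        using zw by (auto simp: X_def)
      then have "f \<sqinter> x \<sqsubseteq> w"
        using zw x sub by (meson le_trans meet_closed subsetD)
      with \<open>f \<in> v\<close> show ?thesis
        using zw by (auto simp: X_def)
    qed
    moreover have "X \<subseteq> carrier L"
      by (auto simp: X_def)
    ultimately have "filt X"
      unfolding filt_def by simp
    moreover have "v \<subseteq> X"
      using sub x by (auto simp: X_def intro!: bexI meet_left)
    moreover have "b \<notin> X"
      using neg by (auto simp: X_def)
    ultimately have "X = v"
      by (rule max)
    moreover have "x \<in> X"
      using v(2) a x by (auto simp: X_def intro!: bexI[of _ a] meet_right)
    ultimately show False
      using x by simp
  qed
  have "x \<in> v \<or> y \<in> v" if xy: "x \<in> carrier L" "y \<in> carrier L" "x \<squnion> y \<in> v" for x y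
  proof (rule ccontr)
    assume "\<not> ?thesis"
    then obtain f g where fg: "f \<in> v" "f \<sqinter> x \<sqsubseteq> b" "g \<in> v" "g \<sqinter> y \<sqsubseteq> b"
      using adjoin xy by metis
    have c: "f \<in> carrier L" "g \<in> carrier L"
      using fg sub by auto
    define h where "h = f \<sqinter> g"
    have h: "h \<in> v" "h \<in> carrier L" "h \<sqsubseteq> f" "h \<sqsubseteq> g"
      unfolding h_def using mt fg c by (auto simp: meet_left meet_right)
    have "h \<sqinter> x \<sqsubseteq> b" "h \<sqinter> y \<sqsubseteq> b"
      using h c xy fg b by (meson meet_closed meet_le meet_left meet_right le_trans)+
    then have "h \<sqinter> (x \<squnion> y) \<sqsubseteq> b"
      using h xy b by (simp add: meet_join_distrib join_le)
    then show False
      using up[OF mt[OF h(1) xy(3)] b] v(3) by simp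
  qed
  moreover have "x \<sqinter> y \<in> v \<longleftrightarrow> x \<in> v \<and> y \<in> v" if "x \<in> carrier L" "y \<in> carrier L" for x y
    using that mt up by (meson meet_left meet_right)
  moreover have "\<top> \<in> v"
    using up[OF v(2)] a by (simp add: top_higher)
  ultimately have "prime_filter L v"
    using sub by (simp add: prime_filter_def)
  with v show ?thesis
    by blast
qed

text \<open>Non-prime \<open>v\<close> count as containing everything, so that \<open>\<top>\<close> becomes \<open>UNIV\<close>.\<close>

definition prime_filter_rep :: "('a, 'm) gorder_scheme \<Rightarrow> 'a \<Rightarrow> 'a set set" where
  "prime_filter_rep I a = {v. prime_filter I v \<longrightarrow> a \<in> v}"

lemma (in implication_lattice) prime_filter_join:
  assumes "prime_filter L v" "x \<in> carrier L" "y \<in> carrier L"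
  shows "x \<squnion> y \<in> v \<longleftrightarrow> x \<in> v \<or> y \<in> v"
proof -
  have "x \<sqinter> (x \<squnion> y) = x" "y \<sqinter> (x \<squnion> y) = y"
    using assms by (metis join_closed join_left join_right meet_eq_left)+
  then show ?thesis
    using assms unfolding prime_filter_def by (metis join_closed)
qed

lemma (in implication_lattice) prime_filter_rep_meet:
  assumes "x \<in> carrier L" "y \<in> carrier L"
  shows "prime_filter_rep L (x \<sqinter> y) = prime_filter_rep L x \<inter> prime_filter_rep L y"
  using assms by (auto simp: prime_filter_rep_def prime_filter_def)

text \<open>For the relative complement \<open>c\<close> of \<open>x \<squnion> y\<close> above \<open>y\<close>, the two equations for the join and meet of
  \<open>c\<close> with \<open>x \<squnion> y\<close> decide which prime filters contain \<open>c\<close>.\<close>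

lemma (in implication_lattice) implication_embedding_prime_filter_rep:
  "implication_embedding L (prime_filter_rep L)"
proof
  show "(.=) = (=)"
    by (rule eq_is_equal)
  show "carrier L \<noteq> {}"
    using top_closed by blast
  show le: "x \<sqsubseteq> y \<longleftrightarrow> prime_filter_rep L x \<subseteq> prime_filter_rep L y"
    if "x \<in> carrier L" "y \<in> carrier L" for x y
  proof
    assume "x \<sqsubseteq> y"
    then show "prime_filter_rep L x \<subseteq> prime_filter_rep L y"
      using that prime_filter_rep_meet[OF that] by (auto simp: meet_eq_left)
  next
    assume "prime_filter_rep L x \<subseteq> prime_filter_rep L y"
    then show "x \<sqsubseteq> y"
      using prime_filter_separates[OF that] by (auto simp: prime_filter_rep_def)
  qed
  show "inj_on (prime_filter_rep L) (carrier L)"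
    using le by (auto simp: inj_on_def intro: le_antisym)
  fix x y assume xy: "x \<in> carrier L" "y \<in> carrier L"
  obtain c where c: "c \<in> carrier L" "y \<sqsubseteq> c" "(x \<squnion> y) \<squnion> c = \<top>" "(x \<squnion> y) \<sqinter> c = y"
    using relative_complement_ex[OF xy] by blast
  have "c \<in> v \<longleftrightarrow> x \<notin> v \<or> y \<in> v" if v: "prime_filter L v" for v
  proof -
    have "x \<in> v \<or> y \<in> v \<or> c \<in> v"
      using v c(1,3) xy prime_filter_join[OF v] by (metis join_closed prime_filter_def)
    moreover have "(x \<in> v \<or> y \<in> v) \<and> c \<in> v \<longleftrightarrow> y \<in> v"
      using v c(1,4) xy prime_filter_join[OF v] by (metis join_closed prime_filter_def)
    ultimately show ?thesis
      by blast
  qed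
  then have "prime_filter_rep L c = - prime_filter_rep L x \<union> prime_filter_rep L y"
    by (auto simp: prime_filter_rep_def)
  with c show "\<exists>z \<in> carrier L. prime_filter_rep L z = - prime_filter_rep L x \<union> prime_filter_rep L y"
    by blast
qed

section \<open>Filter algebras as algebras of faces of a cube\<close>

text \<open>The element \<open>x\<close> is the face of a cube whose coordinates outside \<open>Q x\<close> are fixed to \<open>+\<close> and whose
  coordinates outside \<open>P x\<close> are fixed to \<open>-\<close>.\<close>

locale face_algebra =
  fixes L :: "('a, 'm) cubic_scheme" (structure)
    and P Q :: "'a \<Rightarrow> 'p set" and \<S> :: "'p set set"
  assumes eq_eq: "eq L = (=)"
    and le_iff: "\<lbrakk>x \<in> carrier L; y \<in> carrier L\<rbrakk> \<Longrightarrow> x \<sqsubseteq> y \<longleftrightarrow> P x \<subseteq> P y \<and> Q x \<subseteq> Q y"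
    and face_eqI: "\<lbrakk>x \<in> carrier L; y \<in> carrier L; P x = P y; Q x = Q y\<rbrakk> \<Longrightarrow> x = y"
    and P_in: "x \<in> carrier L \<Longrightarrow> P x \<in> \<S>"
    and Q_in: "x \<in> carrier L \<Longrightarrow> Q x \<in> \<S>"
    and cover: "x \<in> carrier L \<Longrightarrow> P x \<union> Q x = UNIV"
    and face_ex: "\<lbrakk>A \<in> \<S>; B \<in> \<S>; A \<union> B = UNIV\<rbrakk> \<Longrightarrow> \<exists>x \<in> carrier L. P x = A \<and> Q x = B"
    and UNIV_in: "UNIV \<in> \<S>"
    and Int_in: "\<lbrakk>A \<in> \<S>; B \<in> \<S>\<rbrakk> \<Longrightarrow> A \<inter> B \<in> \<S>"
    and imp_in: "\<lbrakk>A \<in> \<S>; B \<in> \<S>\<rbrakk> \<Longrightarrow> - A \<union> B \<in> \<S>"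
    and Delta_in: "\<lbrakk>x \<in> carrier L; y \<in> carrier L; x \<sqsubseteq> y\<rbrakk> \<Longrightarrow> \<Delta> y x \<in> carrier L"
    and P_Delta: "\<lbrakk>x \<in> carrier L; y \<in> carrier L; x \<sqsubseteq> y\<rbrakk> \<Longrightarrow> P (\<Delta> y x) = P y \<inter> (- Q y \<union> Q x)"
    and Q_Delta: "\<lbrakk>x \<in> carrier L; y \<in> carrier L; x \<sqsubseteq> y\<rbrakk> \<Longrightarrow> Q (\<Delta> y x) = Q y \<inter> (- P y \<union> P x)"

lemma Plus_subset_iff: "A <+> B \<subseteq> C <+> D \<longleftrightarrow> A \<subseteq> C \<and> B \<subseteq> D"
  by auto

lemma Plus_eq_iff: "A <+> B = C <+> D \<longleftrightarrow> A = C \<and> B = D"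
  by (auto simp: set_eq_iff Plus_def)

lemma Un_Plus: "(A <+> B) \<union> (C <+> D) = (A \<union> C) <+> (B \<union> D)"
  by auto

lemma Compl_Plus: "- (A <+> B) = - A <+> - B"
proof (rule Set.set_eqI)
  fix x show "x \<in> - (A <+> B) \<longleftrightarrow> x \<in> - A <+> - B"
    by (cases x) auto
qed

text \<open>The disjoint sum places both components of a pair in one power set, where the earlier results on
  \<^locale>\<open>implication_embedding\<close> apply.\<close>

lemma (in implication_lattice) implication_embedding_interval_algebra:
  defines "\<rho> \<equiv> prime_filter_rep L"
  shows "implication_embedding (interval_algebra L) (\<lambda>x. \<rho> (fst x) <+> \<rho> (snd x))"
    and "carrier (interval_algebra L) =
      {(a, b). a \<in> carrier L \<and> b \<in> carrier L \<and> \<rho> a \<union> \<rho> b = UNIV}"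
proof -
  interpret E: implication_embedding L \<rho>
    unfolding \<rho>_def by (rule implication_embedding_prime_filter_rep)
  have top: "a \<squnion> b = \<top> \<longleftrightarrow> \<rho> a \<union> \<rho> b = UNIV" if "a \<in> carrier L" "b \<in> carrier L" for a b
    using that by (metis E.eqI E.join_in E.r_join E.r_top E.top_in)
  show c: "carrier (interval_algebra L) =
      {(a, b). a \<in> carrier L \<and> b \<in> carrier L \<and> \<rho> a \<union> \<rho> b = UNIV}"
    unfolding interval_algebra_def using inf_of_two_exists by (auto simp: top) blast+
  show "implication_embedding (interval_algebra L) (\<lambda>x. \<rho> (fst x) <+> \<rho> (snd x))"
  proof
    show "eq (interval_algebra L) = (=)"
      by (simp add: interval_algebra_def)
    show "carrier (interval_algebra L) \<noteq> {}"
      using E.top_in E.r_top by (auto simp: c)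
    show "inj_on (\<lambda>x. \<rho> (fst x) <+> \<rho> (snd x)) (carrier (interval_algebra L))"
      by (auto simp: c inj_on_def Plus_eq_iff intro: E.eqI)
    fix x y assume xy: "x \<in> carrier (interval_algebra L)" "y \<in> carrier (interval_algebra L)"
    then show "x \<sqsubseteq>\<^bsub>interval_algebra L\<^esub> y \<longleftrightarrow>
        \<rho> (fst x) <+> \<rho> (snd x) \<subseteq> \<rho> (fst y) <+> \<rho> (snd y)"
      unfolding Plus_subset_iff c by (auto simp: interval_algebra_def E.le_iff)
    show "\<exists>z \<in> carrier (interval_algebra L). \<rho> (fst z) <+> \<rho> (snd z) =
        - (\<rho> (fst x) <+> \<rho> (snd x)) \<union> (\<rho> (fst y) <+> \<rho> (snd y))"
      using xy
      by (intro bexI[of _ "(impl L (fst x) (fst y), impl L (snd x) (snd y))"])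
        (auto simp: c E.impl_in E.r_impl Compl_Plus Un_Plus)
  qed
qed

text \<open>An isomorphism of cubic algebras is an order isomorphism, since it preserves joins; so the
  representation of \<open>\<I>(I)\<close> can be pulled back along it.\<close>

lemma filter_algebra_face_algebra:
  fixes L :: "('a, 'm) cubic_scheme"
  assumes "filter_algebra TYPE('b) L"
  obtains P Q :: "'a \<Rightarrow> 'b set set" and \<S> where "face_algebra L P Q \<S>"
proof -
  obtain I :: "'b gorder" and f where "cubic_algebra L" and "implication_lattice I"
      and f: "f \<in> cubic_iso L (interval_algebra I)"
    using assms unfolding filter_algebra_def by blast
  interpret L: cubic_algebra L by fact
  interpret I: implication_lattice I by fact
  define \<rho> where "\<rho> = prime_filter_rep I"
  interpret E: implication_embedding I \<rho>
    unfolding \<rho>_def by (rule I.implication_embedding_prime_filter_rep)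
  interpret J: implication_embedding "interval_algebra I" "\<lambda>x. \<rho> (fst x) <+> \<rho> (snd x)"
    unfolding \<rho>_def by (rule I.implication_embedding_interval_algebra)
  have c: "carrier (interval_algebra I) =
      {(a, b). a \<in> carrier I \<and> b \<in> carrier I \<and> \<rho> a \<union> \<rho> b = UNIV}"
    unfolding \<rho>_def by (rule I.implication_embedding_interval_algebra)
  have bij: "bij_betw f (carrier L) (carrier (interval_algebra I))"
      and fj: "\<And>x y. x \<in> carrier L \<Longrightarrow> y \<in> carrier L \<Longrightarrow>
        f (x \<squnion>\<^bsub>L\<^esub> y) = f x \<squnion>\<^bsub>interval_algebra I\<^esub> f y"
      and fD: "\<And>x y. x \<in> carrier L \<Longrightarrow> y \<in> carrier L \<Longrightarrow> x \<sqsubseteq>\<^bsub>L\<^esub> y \<Longrightarrow>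
        f (\<Delta>\<^bsub>L\<^esub> y x) = \<Delta>\<^bsub>interval_algebra I\<^esub> (f y) (f x)"
    using f unfolding cubic_iso_def by auto
  have fin: "f x \<in> carrier (interval_algebra I)" if "x \<in> carrier L" for x
    using bij that by (rule bij_betw_apply)
  have finj: "x = y" if "x \<in> carrier L" "y \<in> carrier L" "f x = f y" for x y
    using bij that by (auto simp: bij_betw_def inj_on_def)
  define P where "P x = \<rho> (fst (f x))" for x
  define Q where "Q x = \<rho> (snd (f x))" for x
  have fc: "fst (f x) \<in> carrier I" "snd (f x) \<in> carrier I" "P x \<union> Q x = UNIV"
    if "x \<in> carrier L" for x
    using fin[OF that] by (auto simp: c P_def Q_def)
  have Delta: "P (\<Delta>\<^bsub>L\<^esub> y x) = P y \<inter> (- Q y \<union> Q x) \<and> Q (\<Delta>\<^bsub>L\<^esub> y x) = Q y \<inter> (- P y \<union> P x)"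
    if "x \<in> carrier L" "y \<in> carrier L" "x \<sqsubseteq>\<^bsub>L\<^esub> y" for x y
  proof -
    have "f (\<Delta>\<^bsub>L\<^esub> y x) = (fst (f y) \<sqinter>\<^bsub>I\<^esub> impl I (snd (f y)) (snd (f x)),
        snd (f y) \<sqinter>\<^bsub>I\<^esub> impl I (fst (f y)) (fst (f x)))"
      using fD[OF that] by (simp add: interval_algebra_def case_prod_beta)
    then show ?thesis
      using fc[OF that(1)] fc[OF that(2)]
      by (simp add: P_def Q_def \<rho>_def[symmetric] E.impl_in E.r_impl
          I.prime_filter_rep_meet[folded \<rho>_def])
  qed
  have "face_algebra L P Q (\<rho> ` carrier I)"
  proof
    show "eq L = (=)"
      by (rule L.eq_is_equal)
    show "x \<sqsubseteq>\<^bsub>L\<^esub> y \<longleftrightarrow> P x \<subseteq> P y \<and> Q x \<subseteq> Q y" if xy: "x \<in> carrier L" "y \<in> carrier L" for x y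
    proof -
      have "x \<sqsubseteq>\<^bsub>L\<^esub> y \<longleftrightarrow> x \<squnion>\<^bsub>L\<^esub> y = y"
        using xy by (metis L.join_eqI L.join_left L.le_refl)
      also have "\<dots> \<longleftrightarrow> f x \<squnion>\<^bsub>interval_algebra I\<^esub> f y = f y"
        using xy finj fj by (metis L.join_closed)
      also have "\<dots> \<longleftrightarrow> (P x \<union> P y) <+> (Q x \<union> Q y) = P y <+> Q y"
        using J.eqI[OF J.join_in] J.r_join fin xy by (metis P_def Q_def Un_Plus)
      finally show ?thesis
        unfolding Plus_eq_iff by blast
    qed
    show "x = y" if "x \<in> carrier L" "y \<in> carrier L" "P x = P y" "Q x = Q y" for x y
      using that by (auto intro!: finj J.eqI fin simp: P_def Q_def)
    show "P x \<in> \<rho> ` carrier I" "Q x \<in> \<rho> ` carrier I" "P x \<union> Q x = UNIV" if "x \<in> carrier L" for x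
      using fc[OF that] by (auto simp: P_def Q_def)
    show "\<exists>x \<in> carrier L. P x = A \<and> Q x = B"
      if AB: "A \<in> \<rho> ` carrier I" "B \<in> \<rho> ` carrier I" "A \<union> B = UNIV" for A B
    proof -
      obtain a b where ab: "a \<in> carrier I" "b \<in> carrier I" "A = \<rho> a" "B = \<rho> b"
        using AB by blast
      then have "(a, b) \<in> f ` carrier L"
        using bij AB(3) by (simp add: bij_betw_def c)
      then obtain x where "x \<in> carrier L" "f x = (a, b)"
        by force
      with ab show ?thesis
        by (intro bexI[of _ x]) (auto simp: P_def Q_def)
    qed
    show "UNIV \<in> \<rho> ` carrier I"
      using E.top_in E.r_top by blast
    fix A B assume "A \<in> \<rho> ` carrier I" "B \<in> \<rho> ` carrier I"
    then obtain a b where ab: "a \<in> carrier I" "b \<in> carrier I" "A = \<rho> a" "B = \<rho> b"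
      by blast
    then show "A \<inter> B \<in> \<rho> ` carrier I"
      using I.prime_filter_rep_meet[of a b, folded \<rho>_def] by (metis I.meet_closed imageI)
    show "- A \<union> B \<in> \<rho> ` carrier I"
      using ab E.r_impl E.impl_in by (metis imageI)
  qed (use Delta L.Delta_closed in auto)
  then show ?thesis ..
qed

context face_algebra
begin

lemma Un_in:
  assumes "A \<in> \<S>" "B \<in> \<S>"
  shows "A \<union> B \<in> \<S>"
proof -
  have "- (- A \<union> B) \<union> B = A \<union> B"
    by blast
  then show ?thesis
    using imp_in[OF imp_in, OF assms assms(2)] by simp
qed

text \<open>An upward closed set contains the implication \<open>x \<rightarrow> y\<close> together with \<open>y\<close>. For a filter this
  identifies the joins and implications from which \<open>B\<^sub>G\<close> is built.\<close>

lemma implication_embedding_subset: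
  assumes G: "G \<subseteq> carrier L" "G \<noteq> {}"
    and up: "\<And>x y. \<lbrakk>x \<in> G; y \<in> carrier L; P x \<subseteq> P y; Q x \<subseteq> Q y\<rbrakk> \<Longrightarrow> y \<in> G"
  shows "implication_embedding (L\<lparr>carrier := G\<rparr>) (\<lambda>x. P x <+> Q x)"
proof
  show "inj_on (\<lambda>x. P x <+> Q x) (carrier (L\<lparr>carrier := G\<rparr>))"
    using G(1) by (auto simp: inj_on_def Plus_eq_iff intro: face_eqI)
  fix x y assume "x \<in> carrier (L\<lparr>carrier := G\<rparr>)" "y \<in> carrier (L\<lparr>carrier := G\<rparr>)"
  then have xy: "x \<in> G" "y \<in> G" "x \<in> carrier L" "y \<in> carrier L"
    using G(1) by auto
  then show "x \<sqsubseteq>\<^bsub>L\<lparr>carrier := G\<rparr>\<^esub> y \<longleftrightarrow> P x <+> Q x \<subseteq> P y <+> Q y"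
    by (simp add: le_iff Plus_subset_iff)
  have "(- P x \<union> P y) \<union> (- Q x \<union> Q y) = UNIV"
    using cover[OF xy(4)] by blast
  then obtain z where "z \<in> carrier L" "P z = - P x \<union> P y" "Q z = - Q x \<union> Q y"
    using face_ex imp_in P_in Q_in xy(3,4) by metis
  with up[of y z] xy show "\<exists>z \<in> carrier (L\<lparr>carrier := G\<rparr>). P z <+> Q z = - (P x <+> Q x) \<union> (P y <+> Q y)"
    by (intro bexI[of _ z]) (auto simp: Compl_Plus Un_Plus)
qed (use G eq_eq in auto)

sublocale emb: implication_embedding L "\<lambda>x. P x <+> Q x"
proof -
  have "carrier L \<noteq> {}"
    using face_ex UNIV_in by blast
  then show "implication_embedding L (\<lambda>x. P x <+> Q x)"
    using implication_embedding_subset[of "carrier L"] by simp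
qed

lemma
  assumes "x \<in> carrier L" "y \<in> carrier L"
  shows P_join: "P (x \<squnion> y) = P x \<union> P y" and Q_join: "Q (x \<squnion> y) = Q x \<union> Q y"
  using emb.r_join[OF assms] unfolding Un_Plus Plus_eq_iff by blast+

lemma UNIV_Plus: "UNIV = A <+> B \<longleftrightarrow> A = UNIV \<and> B = UNIV"
  using Plus_eq_iff[of UNIV UNIV A B] by auto

lemma shows P_top: "P \<top> = UNIV" and Q_top: "Q \<top> = UNIV"
  using UNIV_Plus[of "P \<top>" "Q \<top>"] emb.r_top by auto

text \<open>The coordinates that the face leaves free.\<close>

definition supp :: "'a \<Rightarrow> 'p set" where
  "supp x = P x \<inter> Q x"

lemma supp_in: "x \<in> carrier L \<Longrightarrow> supp x \<in> \<S>"
  by (simp add: supp_def Int_in P_in Q_in)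

lemma supp_Delta:
  "\<lbrakk>x \<in> carrier L; y \<in> carrier L; x \<sqsubseteq> y\<rbrakk> \<Longrightarrow> supp (\<Delta> y x) = supp x"
  by (auto simp: supp_def P_Delta Q_Delta le_iff)

lemma supp_join:
  "\<lbrakk>x \<in> carrier L; y \<in> carrier L\<rbrakk> \<Longrightarrow> supp x \<subseteq> supp (x \<squnion> y)"
  by (auto simp: supp_def P_join Q_join)

text \<open>Reflections preserve the support and joins enlarge it. So if \<open>G\<close> generates \<open>L\<close>, then every
  support of a face contains the support of a member of \<open>G\<close>.\<close>

lemma cubic_subalgebra_supp:
  assumes G: "G \<subseteq> carrier L" "G \<noteq> {}"
  shows "cubic_subalgebra L {z \<in> carrier L. \<exists>g \<in> G. supp g \<subseteq> supp z}"
  unfolding cubic_subalgebra_def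
proof (intro conjI ballI impI)
  have "supp \<top> = UNIV"
    by (simp add: supp_def P_top Q_top)
  with G show "\<top> \<in> {z \<in> carrier L. \<exists>g \<in> G. supp g \<subseteq> supp z}"
    by (auto simp: emb.top_in)
next
  fix x y
  assume "x \<in> {z \<in> carrier L. \<exists>g \<in> G. supp g \<subseteq> supp z}"
    and "y \<in> {z \<in> carrier L. \<exists>g \<in> G. supp g \<subseteq> supp z}"
  then show "x \<squnion> y \<in> {z \<in> carrier L. \<exists>g \<in> G. supp g \<subseteq> supp z}"
    using supp_join[of x y] by (auto simp: emb.join_in)
qed (auto simp: supp_Delta Delta_in)

text \<open>A vertex need not be given by members of \<open>\<S>\<close>. What is required is that every face of \<open>L\<close> has a
  parallel face in \<open>L\<close>, that is, one with the same support, through the vertex.\<close>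

definition vertex :: "'p set \<Rightarrow> bool" where
  "vertex A \<longleftrightarrow> (\<forall>C \<in> \<S>. A \<union> C \<in> \<S>)"

definition faces_at :: "'p set \<Rightarrow> 'a set" where
  "faces_at A = {x \<in> carrier L. A \<subseteq> P x \<and> - A \<subseteq> Q x}"

lemma vertex_compl:
  assumes "vertex A" "C \<in> \<S>"
  shows "- A \<union> C \<in> \<S>"
proof -
  have "- (A \<union> C) \<union> C \<in> \<S>"
    using assms by (intro imp_in) (auto simp: vertex_def)
  also have "- (A \<union> C) \<union> C = - A \<union> C"
    by blast
  finally show ?thesis .
qed

lemma vertex_sym_diff:
  assumes "vertex A" "vertex B"
  shows "vertex (sym_diff A B)"
  unfolding vertex_def
proof
  fix C assume C: "C \<in> \<S>"
  have "((A \<union> C) \<inter> (- B \<union> C)) \<union> ((B \<union> C) \<inter> (- A \<union> C)) \<in> \<S>"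
    using assms C vertex_compl by (auto simp: vertex_def intro!: Un_in[of "_ \<inter> _"] Int_in)
  also have "((A \<union> C) \<inter> (- B \<union> C)) \<union> ((B \<union> C) \<inter> (- A \<union> C)) = sym_diff A B \<union> C"
    by blast
  finally show "sym_diff A B \<union> C \<in> \<S>" .
qed

lemma faces_at_carrier: "x \<in> faces_at A \<Longrightarrow> x \<in> carrier L"
  by (simp add: faces_at_def)

lemma faces_at_PQ:
  assumes "x \<in> faces_at A"
  shows "P x = A \<union> supp x" "Q x = - A \<union> supp x"
  using assms by (auto simp: faces_at_def supp_def)

lemma faces_at_eqI: "\<lbrakk>x \<in> faces_at A; y \<in> faces_at A; supp x = supp y\<rbrakk> \<Longrightarrow> x = y"
  by (simp add: face_eqI faces_at_PQ faces_at_carrier)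

lemma face_at_ex:
  assumes "vertex A" "C \<in> \<S>"
  obtains x where "x \<in> faces_at A" "supp x = C"
proof -
  have "A \<union> C \<in> \<S>" "- A \<union> C \<in> \<S>"
    using assms vertex_compl by (auto simp: vertex_def)
  then obtain x where "x \<in> carrier L" "P x = A \<union> C" "Q x = - A \<union> C"
    using face_ex[of "A \<union> C" "- A \<union> C"] by blast
  then show ?thesis
    by (intro that[of x]) (auto simp: faces_at_def supp_def)
qed

lemma supp_faces_at: "vertex A \<Longrightarrow> supp ` faces_at A = \<S>"
  using face_at_ex supp_in faces_at_carrier by blast

text \<open>Parallel faces \<open>z\<close> and \<open>g\<close> are mirror images in the smallest face containing both, because
  the latter leaves free exactly the coordinates on which they differ, besides the common
  support.\<close>

lemma Delta_join_face:
  assumes "g \<in> faces_at A" "z \<in> carrier L" "supp g = supp z"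
  shows "z = \<Delta> (z \<squnion> g) g"
proof -
  have g: "g \<in> carrier L"
    using assms(1) by (rule faces_at_carrier)
  have le: "g \<sqsubseteq> z \<squnion> g"
    using g assms(2) by (simp add: le_iff emb.join_in P_join Q_join)
  have eq: "P g \<inter> Q g = P z \<inter> Q z" "P g \<union> Q g = UNIV" "P z \<union> Q z = UNIV"
    using assms g cover by (auto simp: supp_def)
  then show ?thesis
    using g assms(2) le
    by (intro face_eqI) (auto simp: Delta_in P_Delta Q_Delta P_join Q_join emb.join_in)
qed

lemma faces_at_up:
  "\<lbrakk>x \<in> faces_at A; y \<in> carrier L; x \<sqsubseteq> y\<rbrakk> \<Longrightarrow> y \<in> faces_at A"
  by (auto simp: faces_at_def le_iff)

text \<open>If \<open>x\<close> and \<open>y\<close> share a vertex, then \<open>P x \<inter> P y\<close> and \<open>Q x \<inter> Q y\<close> cover all coordinates, so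
  that they form a face of \<open>L\<close>; it is the meet.\<close>

lemma cubic_filter_faces_at:
  assumes "vertex A"
  shows "cubic_filter L (faces_at A)"
  unfolding cubic_filter_def
proof (intro conjI ballI impI)
  show "faces_at A \<noteq> {}"
    using face_at_ex[OF assms UNIV_in] by blast
  fix x y assume xy: "x \<in> faces_at A" "y \<in> faces_at A"
  have "A \<subseteq> P x" "- A \<subseteq> Q x" "A \<subseteq> P y" "- A \<subseteq> Q y"
    using xy by (auto simp: faces_at_def)
  then have "P x \<inter> P y \<union> Q x \<inter> Q y = UNIV"
    by blast
  then obtain m where m: "m \<in> carrier L" "P m = P x \<inter> P y" "Q m = Q x \<inter> Q y"
    using face_ex Int_in P_in Q_in xy[THEN faces_at_carrier] by metis
  show "\<exists>m \<in> faces_at A. greatest L m (Lower L {x, y})"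
  proof
    show "m \<in> faces_at A"
      using m xy by (auto simp: faces_at_def)
    have c: "x \<in> carrier L" "y \<in> carrier L"
      using xy by (auto simp: faces_at_carrier)
    show "greatest L m (Lower L {x, y})"
    proof (rule greatest_LowerI)
      fix n assume "n \<in> Lower L {x, y}"
      then have "n \<in> carrier L" "n \<sqsubseteq> x" "n \<sqsubseteq> y"
        using c by (auto simp: Lower_def)
      then show "n \<sqsubseteq> m"
        using m c by (auto simp: le_iff)
    qed (use m c in \<open>auto simp: le_iff\<close>)
  qed
qed (auto simp: faces_at_carrier intro: faces_at_up)

text \<open>Every face is parallel to a face that contains \<open>A\<close>, and arises from it by a reflection.\<close>

lemma g_filter_faces_at:
  assumes "vertex A"
  shows "g_filter L (faces_at A)"
proof -
  have "carrier L \<subseteq> T" if T: "cubic_subalgebra L T" "faces_at A \<subseteq> T" for T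
  proof
    fix z assume z: "z \<in> carrier L"
    then obtain g where g: "g \<in> faces_at A" "supp g = supp z"
      using face_at_ex[OF assms supp_in] by blast
    have "z = \<Delta> (z \<squnion> g) g"
      using g z by (intro Delta_join_face)
    moreover have "z \<squnion> g \<in> faces_at A" "g \<sqsubseteq> z \<squnion> g"
      using g(1) z by (auto simp: faces_at_def le_iff emb.join_in P_join Q_join)
    ultimately show "z \<in> T"
      using T g unfolding cubic_subalgebra_def by (metis subsetD)
  qed
  moreover have "cubic_subalgebra L (carrier L)"
    by (auto simp: cubic_subalgebra_def emb.top_in emb.join_in Delta_in)
  ultimately have "generated_subalgebra L (faces_at A) = carrier L"
    unfolding generated_subalgebra_def using faces_at_carrier by blast
  then show ?thesis
    by (simp add: g_filter_def cubic_filter_faces_at assms)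
qed

text \<open>Two members of a filter have a common subface, so they never fix a coordinate to opposite
  signs. Together, the members therefore determine a vertex. Since \<open>G\<close> generates \<open>L\<close>, it has a member
  of every support, which leaves no room for further faces through this vertex.\<close>

lemma g_filter_eq_faces_at:
  assumes "g_filter L G"
  obtains A where "vertex A" "G = faces_at A"
proof -
  have filt: "cubic_filter L G" and gen: "generated_subalgebra L G = carrier L"
    using assms by (auto simp: g_filter_def)
  have sub: "G \<subseteq> carrier L" "G \<noteq> {}"
    using filt by (auto simp: cubic_filter_def)
  have compat: "P x \<inter> P y \<union> Q x \<inter> Q y = UNIV" if "x \<in> G" "y \<in> G" for x y
  proof -
    obtain m where m: "m \<in> G" "greatest L m (Lower L {x, y})"
      using filt \<open>x \<in> G\<close> \<open>y \<in> G\<close> unfolding cubic_filter_def by blast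
    have "m \<in> carrier L" "x \<in> carrier L" "y \<in> carrier L" "m \<sqsubseteq> x" "m \<sqsubseteq> y"
      using m sub that by (auto simp: greatest_def Lower_def)
    then show ?thesis
      using cover[of m] by (auto simp: le_iff)
  qed
  \<comment> \<open>the coordinates that some member of \<open>G\<close> fixes to \<open>+\<close>\<close>
  define A where "A = (\<Union>g \<in> G. - Q g)"
  have A: "g \<in> faces_at A" if "g \<in> G" for g
  proof -
    have "A \<subseteq> P g"
      unfolding A_def using compat[OF that] by blast
    moreover have "- A \<subseteq> Q g"
      unfolding A_def using that by blast
    ultimately show ?thesis
      using sub that by (auto simp: faces_at_def)
  qed
  have face: "\<exists>g \<in> G. supp g = supp z" if z: "z \<in> carrier L" for z
  proof -
    have "G \<subseteq> {z \<in> carrier L. \<exists>g \<in> G. supp g \<subseteq> supp z}"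
      using sub by blast
    then have "z \<in> {z \<in> carrier L. \<exists>g \<in> G. supp g \<subseteq> supp z}"
      using z gen cubic_subalgebra_supp[OF sub] unfolding generated_subalgebra_def by blast
    then obtain g where g: "g \<in> G" "supp g \<subseteq> supp z"
      by blast
    have gc: "g \<in> carrier L"
      using g sub by blast
    \<comment> \<open>Freeing the coordinates of \<open>supp z\<close> enlarges \<open>g\<close> to a member of \<open>G\<close> with exactly this support.\<close>
    have "(P g \<union> supp z) \<union> (Q g \<union> supp z) = UNIV"
      using cover[OF gc] by blast
    then obtain h where h: "h \<in> carrier L" "P h = P g \<union> supp z" "Q h = Q g \<union> supp z"
      using face_ex Un_in P_in[OF gc] Q_in[OF gc] supp_in[OF z] by metis
    then have "h \<in> G"
      using filt g(1) gc le_iff[of g h] unfolding cubic_filter_def by blast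
    moreover have "supp h = supp z"
      using h g(2) by (auto simp: supp_def)
    ultimately show ?thesis
      by blast
  qed
  have "vertex A"
    unfolding vertex_def
  proof
    fix C assume "C \<in> \<S>"
    then obtain z where "z \<in> carrier L" "P z = C" "Q z = UNIV"
      using face_ex UNIV_in by blast
    then obtain g where "g \<in> G" "supp g = C"
      using face[of z] by (auto simp: supp_def)
    then show "A \<union> C \<in> \<S>"
      using A faces_at_PQ(1) faces_at_carrier P_in by metis
  qed
  moreover have "G = faces_at A"
    using A face faces_at_eqI faces_at_carrier by (metis subsetI subset_antisym)
  ultimately show ?thesis
    by (rule that)
qed

text \<open>In \<open>z = \<Delta> a b\<close> the faces \<open>z\<close> and \<open>b\<close> are parallel, and \<open>A\<close> lies on a unique face parallel to \<open>z\<close>.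
  The identity \<open>\<Delta> a b \<squnion> b = a\<close> then recovers \<open>a\<close>.\<close>

lemma alpha_beta_faces_at:
  assumes g: "g \<in> faces_at A" and z: "z \<in> carrier L" and "supp g = supp z"
  shows "alpha L (faces_at A) z = z \<squnion> g" and "beta L (faces_at A) z = g"
proof -
  have gc: "g \<in> carrier L"
    using g by (rule faces_at_carrier)
  have mem: "z \<squnion> g \<in> faces_at A" "g \<sqsubseteq> z \<squnion> g"
    using g z by (auto simp: faces_at_def le_iff emb.join_in P_join Q_join)
  have "alpha_beta L (faces_at A) z = (z \<squnion> g, g)"
    unfolding alpha_beta_def
  proof (rule the_equality)
    show "case (z \<squnion> g, g) of (a, b) \<Rightarrow>
        a \<in> faces_at A \<and> b \<in> faces_at A \<and> b \<sqsubseteq> a \<and> z = \<Delta> a b"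
      using mem g Delta_join_face[OF assms] by simp
  next
    fix p assume "case p of (a, b) \<Rightarrow>
        a \<in> faces_at A \<and> b \<in> faces_at A \<and> b \<sqsubseteq> a \<and> z = \<Delta> a b"
    then obtain a b where p: "p = (a, b)" "a \<in> faces_at A" "b \<in> faces_at A" "b \<sqsubseteq> a" "z = \<Delta> a b"
      by (cases p) auto
    have c: "a \<in> carrier L" "b \<in> carrier L"
      using p by (auto simp: faces_at_carrier)
    have b: "b = g"
      using p c assms by (intro faces_at_eqI) (auto simp: supp_Delta)
    have "P b \<subseteq> P a" "Q b \<subseteq> Q a" "P b \<union> Q b = UNIV"
      using p c le_iff cover by auto
    then have "a = z \<squnion> g"
      unfolding b[symmetric] p(5) using p(2-4) c
      by (intro face_eqI) (auto simp: emb.join_in Delta_in P_join Q_join P_Delta Q_Delta)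
    with b p(1) show "p = (z \<squnion> g, g)"
      by simp
  qed
  then show "alpha L (faces_at A) z = z \<squnion> g" "beta L (faces_at A) z = g"
    by (simp_all add: alpha_def beta_def)
qed

lemma beta_in_faces_at:
  assumes "vertex A" "z \<in> carrier L"
  shows "beta L (faces_at A) z \<in> faces_at A" and "supp (beta L (faces_at A) z) = supp z"
proof -
  obtain g where g: "g \<in> faces_at A" "supp g = supp z"
    using assms face_at_ex[OF _ supp_in] by blast
  then show "beta L (faces_at A) z \<in> faces_at A" "supp (beta L (faces_at A) z) = supp z"
    using alpha_beta_faces_at(2) assms by auto
qed

lemma alpha_faces_at:
  assumes "vertex A" "z \<in> carrier L"
  shows "alpha L (faces_at A) z = z \<squnion> beta L (faces_at A) z"
  using alpha_beta_faces_at(1)[OF beta_in_faces_at(1) _ beta_in_faces_at(2)] assms by simp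

text \<open>The coordinates that \<open>\<alpha>(h)\<close> leaves free besides those of \<open>h\<close> are the ones on which \<open>B\<close> and \<open>C\<close>
  differ. The product therefore takes the face through \<open>A\<close> parallel to \<open>h\<close> and flips its signs on
  exactly these coordinates.\<close>

lemma g_filter_mult_faces_at:
  assumes "vertex A" "vertex B" "vertex C"
  shows "g_filter_mult L (faces_at C) (faces_at A) (faces_at B) =
    faces_at (sym_diff C (sym_diff A B))"
proof -
  define mul where
    "mul h = \<Delta> (beta L (faces_at A) (alpha L (faces_at C) h)) (beta L (faces_at A) h)" for h
  have mul: "mul h \<in> faces_at (sym_diff C (sym_diff A B))" "supp (mul h) = supp h"
    if h: "h \<in> faces_at B" for h
  proof -
    have hc: "h \<in> carrier L"
      using h by (rule faces_at_carrier)
    define f where "f = beta L (faces_at C) h"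
    have f: "f \<in> faces_at C" "f \<in> carrier L" "supp f = supp h"
      unfolding f_def using beta_in_faces_at[OF assms(3) hc] faces_at_carrier by auto
    define b where "b = beta L (faces_at A) h"
    have b: "b \<in> faces_at A" "b \<in> carrier L" "supp b = supp h"
      unfolding b_def using beta_in_faces_at[OF assms(1) hc] faces_at_carrier by auto
    define a where "a = beta L (faces_at A) (h \<squnion> f)"
    have a: "a \<in> faces_at A" "a \<in> carrier L" "supp a = supp (h \<squnion> f)"
      unfolding a_def using beta_in_faces_at[OF assms(1) emb.join_in[OF hc f(2)]] faces_at_carrier by auto
    have "supp (h \<squnion> f) = sym_diff B C \<union> supp h"
      using hc f faces_at_PQ[OF h] faces_at_PQ[OF f(1)]
      by (subst supp_def) (auto simp: P_join Q_join)
    then have Pa: "P a = A \<union> (sym_diff B C \<union> supp h)" "Q a = - A \<union> (sym_diff B C \<union> supp h)"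
      using faces_at_PQ[OF a(1)] a(3) by auto
    have Pb: "P b = A \<union> supp h" "Q b = - A \<union> supp h"
      using faces_at_PQ[OF b(1)] b(3) by auto
    have le: "b \<sqsubseteq> a"
      using a b by (auto simp: le_iff Pa Pb)
    have m: "mul h = \<Delta> a b"
      by (simp add: mul_def a_def b_def f_def alpha_faces_at assms hc)
    show "supp (mul h) = supp h"
      using a b le by (simp add: m supp_Delta)
    show "mul h \<in> faces_at (sym_diff C (sym_diff A B))"
      using a b le by (auto simp: m faces_at_def Delta_in P_Delta Q_Delta Pa Pb)
  qed
  have "x \<in> mul ` faces_at B" if x: "x \<in> faces_at (sym_diff C (sym_diff A B))" for x
  proof -
    obtain h where h: "h \<in> faces_at B" "supp h = supp x"
      using face_at_ex[OF assms(2) supp_in] x faces_at_carrier by blast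
    then have "x = mul h"
      using x mul by (intro faces_at_eqI[OF x]) auto
    with h show ?thesis
      by blast
  qed
  then have "faces_at (sym_diff C (sym_diff A B)) = mul ` faces_at B"
    using mul(1) by (intro equalityI subsetI) auto
  then show ?thesis
    by (simp add: g_filter_mult_def mul_def Setcompr_eq_image)
qed

end

section \<open>The twist between two g-filters\<close>

lemma (in implication_embedding) double_algebra_le:
  assumes "x \<in> carrier M" "y \<in> carrier M"
  shows "(x, True) \<sqsubseteq>\<^bsub>double_algebra M\<^esub> (y, True) \<longleftrightarrow> r x \<subseteq> r y"
    and "(x, False) \<sqsubseteq>\<^bsub>double_algebra M\<^esub> (y, True) \<longleftrightarrow> r x \<union> r y = UNIV"
proof -
  have "x \<squnion> y = y \<longleftrightarrow> r x \<subseteq> r y"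
    using assms by (metis eqI join_in r_join subset_Un_eq)
  then show "(x, True) \<sqsubseteq>\<^bsub>double_algebra M\<^esub> (y, True) \<longleftrightarrow> r x \<subseteq> r y"
    by (simp add: double_algebra_def)
  have "impl M x y = y \<longleftrightarrow> - r x \<union> r y = r y"
    using assms by (metis eqI impl_in r_impl)
  then show "(x, False) \<sqsubseteq>\<^bsub>double_algebra M\<^esub> (y, True) \<longleftrightarrow> r x \<union> r y = UNIV"
    by (auto simp: double_algebra_def)
qed

context face_algebra
begin

text \<open>The intersection of \<open>\<S>\<close> collects the coordinates that every face leaves free. On them a vertex
  is undetermined by the faces through it, so they are disregarded.\<close>

definition principal_twist :: "'p set \<Rightarrow> bool" where
  "principal_twist D \<longleftrightarrow> D \<union> \<Inter>\<S> \<in> \<S> \<or> - D \<union> \<Inter>\<S> \<in> \<S>"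

lemma principal_twist_empty: "principal_twist {}"
  using UNIV_in by (simp add: principal_twist_def)

text \<open>The complement of a symmetric difference is the biimplication
  \<open>(- D \<union> E) \<inter> (- E \<union> D)\<close>, which stays inside \<open>\<S>\<close>. Complementing \<open>D\<close> or \<open>E\<close> only complements the
  symmetric difference.\<close>

lemma principal_twist_sym_diff:
  assumes "principal_twist D" "principal_twist E"
  shows "principal_twist (sym_diff D E)"
proof -
  have eq: "principal_twist (sym_diff D E)" if in': "D \<union> \<Inter>\<S> \<in> \<S>" "E \<union> \<Inter>\<S> \<in> \<S>" for D E
  proof -
    have "(- (D \<union> \<Inter>\<S>) \<union> (E \<union> \<Inter>\<S>)) \<inter> (- (E \<union> \<Inter>\<S>) \<union> (D \<union> \<Inter>\<S>)) \<in> \<S>"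
      using in' by (intro Int_in imp_in)
    also have "(- (D \<union> \<Inter>\<S>) \<union> (E \<union> \<Inter>\<S>)) \<inter> (- (E \<union> \<Inter>\<S>) \<union> (D \<union> \<Inter>\<S>)) =
        - sym_diff D E \<union> \<Inter>\<S>"
      by blast
    finally show ?thesis
      by (simp add: principal_twist_def)
  qed
  have compl: "principal_twist (- D) \<longleftrightarrow> principal_twist D" for D
    by (auto simp: principal_twist_def)
  have "sym_diff (- D) E = - sym_diff D E" "sym_diff D (- E) = - sym_diff D E"
      "sym_diff (- D) (- E) = sym_diff D E"
    by blast+
  then show ?thesis
    using assms eq[of D E] eq[of "- D" E] eq[of D "- E"] eq[of "- D" "- E"] compl[of "sym_diff D E"]
    unfolding principal_twist_def[of D] principal_twist_def[of E] by auto
qed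

text \<open>The witness \<open>b\<close> is a face \<open>d\<close> through \<open>B\<close> with a tag, and thus amounts to its support and a
  choice between \<open>D\<close> and its complement, where \<open>D\<close> is the symmetric difference. Of the two components of the
  inequality for a face \<open>f\<close> through \<open>A\<close>, one bounds the support of \<open>d\<close> from above and the other from
  below, and together they make it agree with \<open>D\<close>, or with its complement, off the support of \<open>f\<close>.
  Letting \<open>f\<close> vary leaves only the intersection of all supports undetermined.\<close>

lemma untwisted_faces_at:
  assumes A: "vertex A" and B: "vertex B"
  shows "untwisted L (faces_at A) (faces_at B) \<longleftrightarrow> principal_twist (sym_diff A B)"
proof -
  define D where "D = sym_diff A B"
  let ?M = "L\<lparr>carrier := faces_at B\<rparr>"
  have "faces_at B \<noteq> {}"
    using face_at_ex[OF B UNIV_in] by blast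
  then interpret M: implication_embedding ?M "\<lambda>x. P x <+> Q x"
    by (intro implication_embedding_subset) (auto simp: faces_at_def)
  have le: "(double_compl (d, i), (d, i)) \<sqsubseteq>\<^bsub>interval_algebra (filter_double L (faces_at B))\<^esub>
        phi L (faces_at B) f \<longleftrightarrow>
      supp d \<union> supp f = (if i then D else - D) \<union> supp f"
    if d: "d \<in> faces_at B" and f: "f \<in> faces_at A" for d f i
  proof -
    have fc: "f \<in> carrier L" and fP: "P f = A \<union> supp f" "Q f = - A \<union> supp f"
      using f faces_at_PQ[OF f] by (auto simp: faces_at_def)
    define g where "g = beta L (faces_at B) f"
    have gB: "g \<in> faces_at B" and gs: "supp g = supp f"
      unfolding g_def using beta_in_faces_at[OF B fc] by auto
    have g: "g \<in> carrier L" "P g = B \<union> supp f" "Q g = - B \<union> supp f"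
      using gB gs faces_at_PQ[OF gB] by (auto simp: faces_at_def)
    have dP: "P d = B \<union> supp d" "Q d = - B \<union> supp d"
      using faces_at_PQ[OF d] .
    have ftop: "f \<sqsubseteq> \<top>"
      using fc by (simp add: le_iff emb.top_in P_top Q_top)
    have opp: "\<Delta> \<top> f \<in> carrier L" "P (\<Delta> \<top> f) = Q f" "Q (\<Delta> \<top> f) = P f"
      using ftop fc by (auto simp: Delta_in P_Delta Q_Delta emb.top_in P_top Q_top)
    define u where "u = \<Delta> \<top> f \<squnion> g"
    define w where "w = f \<squnion> g"
    have u: "u \<in> carrier L" "P u = - A \<union> B \<union> supp f" "Q u = A \<union> - B \<union> supp f"
      using opp g fP by (auto simp: u_def emb.join_in P_join Q_join)
    have w: "w \<in> carrier L" "P w = A \<union> B \<union> supp f" "Q w = - A \<union> - B \<union> supp f"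
      using fc g fP by (auto simp: w_def emb.join_in P_join Q_join)
    have mem: "d \<in> carrier ?M" "u \<in> carrier ?M" "w \<in> carrier ?M"
      using d u w by (auto simp: faces_at_def)
    have "(double_compl (d, i), (d, i)) \<sqsubseteq>\<^bsub>interval_algebra (filter_double L (faces_at B))\<^esub>
        phi L (faces_at B) f \<longleftrightarrow>
      (d, \<not> i) \<sqsubseteq>\<^bsub>double_algebra ?M\<^esub> (u, True) \<and> (d, i) \<sqsubseteq>\<^bsub>double_algebra ?M\<^esub> (w, True)"
      by (simp add: interval_algebra_def double_compl_def phi_def u_def w_def g_def)
    also have "\<dots> \<longleftrightarrow> supp d \<union> supp f = (if i then D else - D) \<union> supp f"
    proof (cases i)
      case True
      have "P d \<subseteq> P w \<and> Q d \<subseteq> Q w \<longleftrightarrow> supp d \<subseteq> D \<union> supp f"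
        unfolding dP w D_def by blast
      moreover have "P d \<union> P u = UNIV \<and> Q d \<union> Q u = UNIV \<longleftrightarrow> D \<subseteq> supp d \<union> supp f"
        unfolding dP u D_def by blast
      ultimately show ?thesis
        using True M.double_algebra_le(2)[OF mem(1,2)] M.double_algebra_le(1)[OF mem(1,3)]
        by (auto simp: Plus_subset_iff Un_Plus UNIV_Plus[THEN eq_iff_swap])
    next
      case False
      have "P d \<subseteq> P u \<and> Q d \<subseteq> Q u \<longleftrightarrow> supp d \<subseteq> - D \<union> supp f"
        unfolding dP u D_def by blast
      moreover have "P d \<union> P w = UNIV \<and> Q d \<union> Q w = UNIV \<longleftrightarrow> - D \<subseteq> supp d \<union> supp f"
        unfolding dP w D_def by blast
      ultimately show ?thesis
        using False M.double_algebra_le(1)[OF mem(1,2)] M.double_algebra_le(2)[OF mem(1,3)]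
        by (auto simp: Plus_subset_iff Un_Plus UNIV_Plus[THEN eq_iff_swap])
    qed
    finally show ?thesis .
  qed
  have pr: "(\<forall>C \<in> \<S>. e \<union> C = X \<union> C) \<longleftrightarrow> e = X \<union> \<Inter>\<S>" if "e \<in> \<S>" for e X
    using that by blast
  have "untwisted L (faces_at A) (faces_at B) \<longleftrightarrow> (\<exists>p \<in> faces_at B \<times> UNIV. \<forall>f \<in> faces_at A.
      (double_compl p, p) \<sqsubseteq>\<^bsub>interval_algebra (filter_double L (faces_at B))\<^esub> phi L (faces_at B) f)"
    using A B by (simp add: untwisted_def g_filter_faces_at double_algebra_def[of ?M])
  also have "\<dots> \<longleftrightarrow> (\<exists>i. \<exists>d \<in> faces_at B. \<forall>f \<in> faces_at A.
      (double_compl (d, i), (d, i)) \<sqsubseteq>\<^bsub>interval_algebra (filter_double L (faces_at B))\<^esub>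
        phi L (faces_at B) f)"
    by blast
  also have "\<dots> \<longleftrightarrow> (\<exists>i. \<exists>d \<in> faces_at B. \<forall>f \<in> faces_at A.
      supp d \<union> supp f = (if i then D else - D) \<union> supp f)"
    by (simp only: le cong: bex_cong ball_cong)
  also have "\<dots> \<longleftrightarrow> (\<exists>i. \<exists>e \<in> supp ` faces_at B. \<forall>C \<in> supp ` faces_at A.
      e \<union> C = (if i then D else - D) \<union> C)"
    by (simp only: bex_simps ball_simps)
  also have "\<dots> \<longleftrightarrow> (\<exists>i. \<exists>e \<in> \<S>. e = (if i then D else - D) \<union> \<Inter>\<S>)"
    by (simp only: supp_faces_at A B pr cong: bex_cong)
  also have "\<dots> \<longleftrightarrow> principal_twist D"
    by (auto simp: principal_twist_def ex_bool_eq)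
  finally show ?thesis
    by (simp add: D_def)
qed

lemma equiv_untwisted: "equiv {G. g_filter L G} (untwisted_rel L)"
proof (rule equivI)
  show "untwisted_rel L \<subseteq> {G. g_filter L G} \<times> {G. g_filter L G}"
    by (auto simp: untwisted_rel_def untwisted_def)
  show "refl_on {G. g_filter L G} (untwisted_rel L)"
  proof (rule refl_onI)
    fix G assume "G \<in> {G. g_filter L G}"
    then obtain A where "vertex A" "G = faces_at A"
      using g_filter_eq_faces_at by blast
    then show "(G, G) \<in> untwisted_rel L"
      by (simp add: untwisted_rel_def untwisted_faces_at principal_twist_empty)
  qed
  show "sym (untwisted_rel L)"
  proof (rule symI)
    fix G H assume "(G, H) \<in> untwisted_rel L"
    then have GH: "untwisted L G H" "g_filter L G" "g_filter L H"
      by (auto simp: untwisted_rel_def untwisted_def)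
    obtain A B where "vertex A" "G = faces_at A" "vertex B" "H = faces_at B"
      using g_filter_eq_faces_at GH by metis
    then show "(H, G) \<in> untwisted_rel L"
      using GH by (simp add: untwisted_rel_def untwisted_faces_at Un_commute)
  qed
  show "trans (untwisted_rel L)"
  proof (rule transI)
    fix G H K assume "(G, H) \<in> untwisted_rel L" "(H, K) \<in> untwisted_rel L"
    then have GHK: "untwisted L G H" "untwisted L H K" "g_filter L G" "g_filter L H" "g_filter L K"
      by (auto simp: untwisted_rel_def untwisted_def)
    obtain A B C where v: "vertex A" "G = faces_at A" "vertex B" "H = faces_at B"
        "vertex C" "K = faces_at C"
      using g_filter_eq_faces_at GHK by metis
    then have "principal_twist (sym_diff (sym_diff A B) (sym_diff B C))"
      using GHK by - (rule principal_twist_sym_diff; simp add: untwisted_faces_at)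
    moreover have "sym_diff (sym_diff A B) (sym_diff B C) = sym_diff A C"
      by blast
    ultimately show "(G, K) \<in> untwisted_rel L"
      using v by (simp add: untwisted_rel_def untwisted_faces_at)
  qed
qed

lemma untwisted_mult:
  assumes "g_filter L F" and un: "untwisted L G1 G2" "untwisted L H1 H2"
  shows "untwisted L (g_filter_mult L F G1 H1) (g_filter_mult L F G2 H2)"
proof -
  have g: "g_filter L G1" "g_filter L G2" "g_filter L H1" "g_filter L H2"
    using un by (auto simp: untwisted_def)
  obtain C where C: "vertex C" "F = faces_at C"
    using g_filter_eq_faces_at[OF assms(1)] .
  obtain A1 where A1: "vertex A1" "G1 = faces_at A1"
    using g_filter_eq_faces_at[OF g(1)] .
  obtain A2 where A2: "vertex A2" "G2 = faces_at A2"
    using g_filter_eq_faces_at[OF g(2)] .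
  obtain B1 where B1: "vertex B1" "H1 = faces_at B1"
    using g_filter_eq_faces_at[OF g(3)] .
  obtain B2 where B2: "vertex B2" "H2 = faces_at B2"
    using g_filter_eq_faces_at[OF g(4)] .
  have "principal_twist (sym_diff (sym_diff A1 A2) (sym_diff B1 B2))"
    using un A1 A2 B1 B2 by - (rule principal_twist_sym_diff; simp add: untwisted_faces_at)
  moreover have "sym_diff (sym_diff A1 A2) (sym_diff B1 B2) =
      sym_diff (sym_diff C (sym_diff A1 B1)) (sym_diff C (sym_diff A2 B2))"
    by blast
  ultimately show ?thesis
    using A1 A2 B1 B2 C by (simp add: g_filter_mult_faces_at untwisted_faces_at vertex_sym_diff)
qed

end

theorem theorem4p3:
  fixes L :: "'a cubic" and F :: "'a set"
  assumes "filter_algebra TYPE('b) L"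
    and "g_filter L F"
  shows "equiv {G. g_filter L G} (untwisted_rel L) \<and>
    (\<forall>G1 G2 H1 H2. untwisted L G1 G2 \<longrightarrow> untwisted L H1 H2 \<longrightarrow>
       untwisted L (g_filter_mult L F G1 H1) (g_filter_mult L F G2 H2))"
proof -
  obtain P Q :: "'a \<Rightarrow> 'b set set" and \<S> where "face_algebra L P Q \<S>"
    using filter_algebra_face_algebra[OF assms(1)] .
  then interpret face_algebra L P Q \<S> .
  show ?thesis
    using equiv_untwisted untwisted_mult[OF assms(2)] by blast
qed

end
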